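(* Let $x\in\mathbb{R}^n$, let $v_1,\dots,v_k\in S^{n-1}$ be projectively independent directions, and let $F_i\subset[0,\rho]$ $(1\le i\le k)$ be bounded sets such that $0\in F_i$ and $0\in\overline{F_i\setminus\{0\}}$. Let \[ \mathcal F=\bigcup_{i=1}^k\{x+tv_i:t\in F_i\},\qquad d_i:=\dim_{\mathrm{Pbox}}\{0\}_{F_i}. \] Then \[ \mathrm{Eff}_x^{\mathbb P}(\mathcal F)=\{[v_1],\dots,[v_k]\}, \] and $\theta_x^{\mathcal F}([v_i])=d_i$ for $1\le i\le k$. Consequently, \[ \dim_{\times}\{x\}_{\mathcal F}=\sum_{i=1}^k d_i. \] Moreover, \[ \dim_{\mathrm{Pbox}}\{x\}_{\mathcal F}=\max_{1\le i\le k}d_i, \] and consequently \[ \dim_{\boxtimes}\{x\}_{\mathcal F}=\sum_{i=1}^k d_i. \] Finally, $\dim_{\mathrm{Ptan}}\{x\}_{\mathcal F}=k$.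
   Context: "Projectively independent" means that the vectors (equivalently, nonzero representatives of the projective classes) are linearly independent. For $v\ne0$, $[v]=\mathbb{R}v\in\mathbb{P}^{n-1}$. Tangent cone: for $A\subset\mathbb{R}^n$, $\mathrm{Tan}_x(A)$ is the set of $v\in\mathbb{R}^n$ for which there exist $x_k\in A$, $x_k\to x$, and positive reals $\lambda_k\downarrow0$ with $(x_k-x)/\lambda_k\to v$. Point-tangential dimension: $\dim_{\mathrm{Ptan}}\{x\}_A:=\dim\mathrm{span}(\mathrm{Tan}_x(A))$, with $\mathrm{span}(\varnothing)=\{0\}$. Effective directions: $\mathrm{Eff}_x(A):=\mathrm{Tan}_x(A)\cap S^{n-1}$ if $x\in\overline A$ (and $\varnothing$ otherwise); $\mathrm{Eff}_x^{\mathbb P}(A):=\{[v]:v\in\mathrm{Eff}_x(A)\}$. Admissible probes: for $x\in\overline A$, $v\in S^{n-1}$, $\mathcal G_x^A(v)$ is the family of all injective Lipschitz maps $\gamma:[0,\delta]\to\mathbb{R}^n$ (some $\delta>0$) with $\gamma(0)=x$, $\lim_{t\to0^+}\frac{\gamma(t)-x}{\|\gamma(t)-x\|}=v$, and $A\cap\gamma((0,\eta])\ne\varnothing$ for every $\eta\in(0,\delta]$; $\Gamma_\gamma:=\gamma([0,\delta])$. Point-extended box dimension: for bounded $E$, $N_\varepsilon(E)$ is the minimal number of sets of diameter at most $\varepsilon$ covering $E$ and $\overline{\dim}_B(E):=\limsup_{\varepsilon\to0}\frac{\ln N_\varepsilon(E)}{\ln(1/\varepsilon)}$. For $x\in\overline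 E$, $\dim_{\mathrm{Pbox}}\{x\}_E:=\inf_{r>0}\overline{\dim}_B(E\cap B(x,r))$; it is $0$ if $x\notin\overline E$. Directional contribution: for $v\in\mathrm{Eff}_x(A)$, $\theta_x^A(v):=\sup_{\gamma\in\mathcal G_x^A(v)}\dim_{\mathrm{Pbox}}\{x\}_{A\cap\Gamma_\gamma}$; for $\xi\in\mathrm{Eff}_x^{\mathbb P}(A)$, $\theta_x^A(\xi):=\sup\{\theta_x^A(w):w\in\mathrm{Eff}_x(A),[w]=\xi\}$. Point-Cross dimension at $x\in\overline A$: $\dim_\times\{x\}_A:=\sup\sum_{i=1}^m\theta_x^A(\xi_i)$ over all $m\in\{0,\dots,n\}$ and all projectively independent $\xi_1,\dots,\xi_m\in\mathrm{Eff}_x^{\mathbb P}(A)$ (empty family allowed, with sum $0$). Point-Box-Cross dimension: $\dim_{\boxtimes}\{x\}_A:=\max\{\dim_{\mathrm{Pbox}}\{x\}_A,\dim_\times\{x\}_A\}$. *)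

theory Defs
  imports "HOL-Analysis.Analysis"
begin

text \<open>
  The dimensions below take values in \<^typ>\<open>ereal\<close>, so that limits superior, infima and
  suprema need no side conditions; the ambient space R^n is any \<^class>\<open>euclidean_space\<close>
  of dimension n.
\<close>

text \<open>The point \<open>[v] = \<real>v\<close> of projective space, as the line through \<open>v\<close>; meant for \<open>v \<noteq> 0\<close>.\<close>

definition proj_class :: "'a::real_vector \<Rightarrow> 'a set" where
  "proj_class v = span {v}"

text \<open>
  Linear independence of an indexed family: \<^const>\<open>independent\<close> only sees the set of values, so
  repetitions have to be excluded separately.
\<close>

definition independent_family :: "'i set \<Rightarrow> ('i \<Rightarrow> 'a::real_vector) \<Rightarrow> bool" where
  "independent_family I v \<longleftrightarrow> inj_on v I \<and> independent (v ` I)"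

definition proj_independent :: "'i set \<Rightarrow> ('i \<Rightarrow> 'a::real_vector set) \<Rightarrow> bool" where
  "proj_independent I \<xi> \<longleftrightarrow>
     (\<exists>w. (\<forall>i\<in>I. w i \<noteq> 0 \<and> proj_class (w i) = \<xi> i) \<and> independent_family I w)"

definition tangent_cone :: "'a::real_normed_vector \<Rightarrow> 'a set \<Rightarrow> 'a set" where
  "tangent_cone x A =
     {v. \<exists>y l. (\<forall>j::nat. y j \<in> A) \<and> y \<longlonglongrightarrow> x \<and>
               (\<forall>j. l j > (0::real)) \<and> decseq l \<and> l \<longlonglongrightarrow> 0 \<and>
               (\<lambda>j. (y j - x) /\<^sub>R l j) \<longlonglongrightarrow> v}"

definition dim_Ptan :: "'a::euclidean_space \<Rightarrow> 'a set \<Rightarrow> nat" where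
  "dim_Ptan x A = dim (span (tangent_cone x A))"

definition Eff :: "'a::real_normed_vector \<Rightarrow> 'a set \<Rightarrow> 'a set" where
  "Eff x A = (if x \<in> closure A then tangent_cone x A \<inter> sphere 0 1 else {})"

definition Eff_proj :: "'a::real_normed_vector \<Rightarrow> 'a set \<Rightarrow> 'a set set" where
  "Eff_proj x A = proj_class ` Eff x A"

text \<open>
  A map on \<open>[0, \<delta>]\<close> is encoded as a pair of \<open>\<delta>\<close> and a total function, whose values
  outside \<open>[0, \<delta>]\<close> are irrelevant.
\<close>

definition probes :: "'a::real_normed_vector \<Rightarrow> 'a set \<Rightarrow> 'a \<Rightarrow> (real \<times> (real \<Rightarrow> 'a)) set" where
  "probes x A v =
     {(\<delta>, \<gamma>). \<delta> > 0 \<and> inj_on \<gamma> {0..\<delta>} \<and> (\<exists>L. L-lipschitz_on {0..\<delta>} \<gamma>) \<and> \<gamma> 0 = x \<and>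
              ((\<lambda>t. (\<gamma> t - x) /\<^sub>R norm (\<gamma> t - x)) \<longlongrightarrow> v) (at_right 0) \<and>
              (\<forall>\<eta>\<in>{0<..\<delta>}. A \<inter> \<gamma> ` {0<..\<eta>} \<noteq> {})}"

text \<open>
  The conjunct \<^term>\<open>bounded U\<close> is needed because \<^const>\<open>diameter\<close> is unspecified on unbounded sets.
  The infimum, over natural numbers, is meaningful for totally bounded \<open>E\<close>, in particular for
  bounded subsets of a Euclidean space.
\<close>

definition covering_number :: "real \<Rightarrow> 'a::metric_space set \<Rightarrow> nat" where
  "covering_number \<epsilon> E =
     Inf (card ` {\<U>. finite \<U> \<and> (\<forall>U\<in>\<U>. bounded U \<and> diameter U \<le> \<epsilon>) \<and> E \<subseteq> \<Union>\<U>})"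

definition upper_box_dim :: "'a::metric_space set \<Rightarrow> ereal" where
  "upper_box_dim E =
     Limsup (at_right 0) (\<lambda>\<epsilon>. ereal (ln (real (covering_number \<epsilon> E)) / ln (1 / \<epsilon>)))"

definition dim_Pbox :: "'a::metric_space \<Rightarrow> 'a set \<Rightarrow> ereal" where
  "dim_Pbox x E =
     (if x \<in> closure E then INF r\<in>{0<..}. upper_box_dim (E \<inter> ball x r) else 0)"

text \<open>
  Both contributions are meant for effective directions only; elsewhere the index set of the
  supremum may be empty, and the value is then \<open>-\<infinity>\<close>.
\<close>

definition theta :: "'a::real_normed_vector \<Rightarrow> 'a set \<Rightarrow> 'a \<Rightarrow> ereal" where
  "theta x A v = (SUP (\<delta>, \<gamma>)\<in>probes x A v. dim_Pbox x (A \<inter> \<gamma> ` {0..\<delta>}))"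

definition theta_proj :: "'a::real_normed_vector \<Rightarrow> 'a set \<Rightarrow> 'a set \<Rightarrow> ereal" where
  "theta_proj x A \<xi> = (SUP w\<in>{w \<in> Eff x A. proj_class w = \<xi>}. theta x A w)"

definition dim_cross :: "'a::euclidean_space \<Rightarrow> 'a set \<Rightarrow> ereal" where
  "dim_cross x A =
     Sup {(\<Sum>i=1..m. theta_proj x A (\<xi> i)) | m \<xi>.
            m \<le> DIM('a) \<and> (\<forall>i\<in>{1..m::nat}. \<xi> i \<in> Eff_proj x A) \<and> proj_independent {1..m} \<xi>}"

definition dim_boxcross :: "'a::euclidean_space \<Rightarrow> 'a set \<Rightarrow> ereal" where
  "dim_boxcross x A = max (dim_Pbox x A) (dim_cross x A)"

end

theory Submission
  imports Defs
begin

text \<open>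
  Near \<open>x\<close> the secant directions of \<open>\<F>\<close> from \<open>x\<close> take only the values \<open>v\<^sub>1, \<dots>, v\<^sub>k\<close>, so a probe
  whose secants converge to \<open>v\<^sub>i\<close> meets \<open>\<F>\<close> near \<open>x\<close> only in the \<open>i\<close>-th branch, an isometric copy of
  \<open>F\<^sub>i\<close>; the straight probe meets all of that branch. Hence the contribution of \<open>[v\<^sub>i]\<close> is
  exactly \<open>d\<^sub>i\<close>. As the \<open>d\<^sub>i\<close> are nonnegative, the supremum defining the point-cross dimension is
  attained at the full family. The point-box dimension follows from finite stability of the upper box
  dimension.
\<close>

section \<open>Covering numbers\<close>

text \<open>Total boundedness makes the infimum in \<open>covering_number\<close> range over a
  nonempty set; balls of radius \<open>\<epsilon>/2\<close> have the required diameter.\<close>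

lemma finite_cover_exists:
  fixes E :: "'a::euclidean_space set"
  assumes "bounded E" "\<epsilon> > 0"
  shows "\<exists>\<U>. finite \<U> \<and> (\<forall>U\<in>\<U>. bounded U \<and> diameter U \<le> \<epsilon>) \<and> E \<subseteq> \<Union>\<U>"
proof -
  have "compact (closure E)"
    using assms by simp
  then obtain C where C: "finite C" "closure E \<subseteq> (\<Union>c\<in>C. ball c (\<epsilon>/2))"
    using \<open>\<epsilon> > 0\<close> unfolding compact_eq_totally_bounded by (meson half_gt_zero)
  have "diameter (ball c (\<epsilon>/2)) \<le> \<epsilon>" for c :: 'a
    using \<open>\<epsilon> > 0\<close> by simp
  moreover have "E \<subseteq> (\<Union>c\<in>C. ball c (\<epsilon>/2))"
    using C(2) closure_subset by (rule order_trans[rotated])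
  ultimately show ?thesis
    using C(1) by (intro exI[of _ "(\<lambda>c. ball c (\<epsilon>/2)) ` C"]) simp
qed

lemma covering_number_attained:
  fixes E :: "'a::euclidean_space set"
  assumes "bounded E" "\<epsilon> > 0"
  obtains \<U> where "finite \<U>" "\<And>U. U \<in> \<U> \<Longrightarrow> bounded U" "\<And>U. U \<in> \<U> \<Longrightarrow> diameter U \<le> \<epsilon>"
    "E \<subseteq> \<Union>\<U>" "card \<U> = covering_number \<epsilon> E"
proof -
  have "covering_number \<epsilon> E
    \<in> card ` {\<U>. finite \<U> \<and> (\<forall>U\<in>\<U>. bounded U \<and> diameter U \<le> \<epsilon>) \<and> E \<subseteq> \<Union>\<U>}"
    unfolding covering_number_def
    by (rule Inf_nat_def1) (use finite_cover_exists[OF assms] in blast)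
  then obtain \<U> where "finite \<U>" "\<forall>U\<in>\<U>. bounded U \<and> diameter U \<le> \<epsilon>"
    "E \<subseteq> \<Union>\<U>" "card \<U> = covering_number \<epsilon> E"
    by fastforce
  then show ?thesis
    by (intro that) blast+
qed

lemma covering_number_le_card:
  assumes "finite \<U>" "\<And>U. U \<in> \<U> \<Longrightarrow> bounded U" "\<And>U. U \<in> \<U> \<Longrightarrow> diameter U \<le> \<epsilon>" "E \<subseteq> \<Union>\<U>"
  shows "covering_number \<epsilon> E \<le> card \<U>"
  unfolding covering_number_def using assms by (intro cInf_lower) auto

lemma covering_number_empty [simp]: "covering_number \<epsilon> {} = 0"
  using covering_number_le_card[of "{}" \<epsilon> "{}"] by simp

lemma covering_number_mono:
  fixes B :: "'a::euclidean_space set"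
  assumes "A \<subseteq> B" "bounded B" "\<epsilon> > 0"
  shows "covering_number \<epsilon> A \<le> covering_number \<epsilon> B"
proof -
  obtain \<U> where \<U>: "finite \<U>" "\<And>U. U \<in> \<U> \<Longrightarrow> bounded U" "\<And>U. U \<in> \<U> \<Longrightarrow> diameter U \<le> \<epsilon>"
    "B \<subseteq> \<Union>\<U>" "card \<U> = covering_number \<epsilon> B"
    by (rule covering_number_attained[OF assms(2,3)], rule that)
  have "covering_number \<epsilon> A \<le> card \<U>"
    using \<U> \<open>A \<subseteq> B\<close> by (intro covering_number_le_card) auto
  with \<U> show ?thesis by simp
qed

lemma covering_number_Un_le:
  fixes A B :: "'a::euclidean_space set"
  assumes "bounded A" "bounded B" "\<epsilon> > 0"
  shows "covering_number \<epsilon> (A \<union> B) \<le> covering_number \<epsilon> A + covering_number \<epsilon> B"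
proof -
  obtain \<U> where \<U>: "finite \<U>" "\<And>U. U \<in> \<U> \<Longrightarrow> bounded U" "\<And>U. U \<in> \<U> \<Longrightarrow> diameter U \<le> \<epsilon>"
    "A \<subseteq> \<Union>\<U>" "card \<U> = covering_number \<epsilon> A"
    by (rule covering_number_attained[OF assms(1,3)], rule that)
  obtain \<V> where \<V>: "finite \<V>" "\<And>U. U \<in> \<V> \<Longrightarrow> bounded U" "\<And>U. U \<in> \<V> \<Longrightarrow> diameter U \<le> \<epsilon>"
    "B \<subseteq> \<Union>\<V>" "card \<V> = covering_number \<epsilon> B"
    by (rule covering_number_attained[OF assms(2,3)], rule that)
  have "covering_number \<epsilon> (A \<union> B) \<le> card (\<U> \<union> \<V>)"
    using \<U> \<V> by (intro covering_number_le_card) auto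
  also have "\<dots> \<le> card \<U> + card \<V>"
    by (rule card_Un_le)
  finally show ?thesis
    using \<U> \<V> by simp
qed

text \<open>Push an optimal cover forward along \<open>f\<close>. Each member is first cut down to
  \<open>E\<close>, because distances are controlled only there.\<close>

lemma covering_number_nonexpansive_image_le:
  fixes f :: "'a::euclidean_space \<Rightarrow> 'b::euclidean_space"
  assumes "bounded E" "\<epsilon> > 0"
    and f: "\<And>a b. a \<in> E \<Longrightarrow> b \<in> E \<Longrightarrow> dist (f a) (f b) \<le> dist a b"
  shows "covering_number \<epsilon> (f ` E) \<le> covering_number \<epsilon> E"
proof -
  obtain \<U> where \<U>: "finite \<U>" "\<And>U. U \<in> \<U> \<Longrightarrow> bounded U" "\<And>U. U \<in> \<U> \<Longrightarrow> diameter U \<le> \<epsilon>"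
    "E \<subseteq> \<Union>\<U>" "card \<U> = covering_number \<epsilon> E"
    by (rule covering_number_attained[OF assms(1,2)], rule that)
  have d: "dist a b \<le> \<epsilon>" if ab: "U \<in> \<U>" "a \<in> f ` (U \<inter> E)" "b \<in> f ` (U \<inter> E)" for U a b
  proof -
    obtain p q where pq: "p \<in> U" "q \<in> U" "p \<in> E" "q \<in> E" "a = f p" "b = f q"
      using ab by blast
    have "dist a b \<le> dist p q"
      using f pq by simp
    also have "\<dots> \<le> diameter U"
      using pq \<U>(2)[OF ab(1)] by (intro diameter_bounded_bound)
    also have "\<dots> \<le> \<epsilon>"
      using \<U>(3) ab by simp
    finally show ?thesis .
  qed
  have "covering_number \<epsilon> (f ` E) \<le> card ((\<lambda>U. f ` (U \<inter> E)) ` \<U>)"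
  proof (rule covering_number_le_card)
    fix V assume "V \<in> (\<lambda>U. f ` (U \<inter> E)) ` \<U>"
    then obtain U where U: "U \<in> \<U>" "V = f ` (U \<inter> E)"
      by auto
    show "bounded V"
      unfolding U bounded_two_points using d[OF U(1)] by blast
    \<comment> \<open>The trace \<open>U \<inter> E\<close> may be empty; positivity of
      \<open>\<epsilon>\<close> handles that case in \<open>diameter_le\<close>.\<close>
    show "diameter V \<le> \<epsilon>"
      unfolding U by (rule diameter_le) (use d[OF U(1)] \<open>\<epsilon> > 0\<close> in \<open>auto simp: dist_norm\<close>)
  next
    show "f ` E \<subseteq> \<Union>((\<lambda>U. f ` (U \<inter> E)) ` \<U>)"
      using \<U>(4) by blast
  qed (use \<U> in simp)
  also have "\<dots> \<le> card \<U>"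
    by (rule card_image_le) fact
  finally show ?thesis
    using \<U> by simp
qed

text \<open>Both \<open>f\<close> on \<open>E\<close> and its inverse on the image are nonexpansive,
  so the previous inequality applies in each direction.\<close>

lemma covering_number_isometric_image:
  fixes f :: "'a::euclidean_space \<Rightarrow> 'b::euclidean_space"
  assumes "bounded E" "\<epsilon> > 0"
    and f: "\<And>a b. a \<in> E \<Longrightarrow> b \<in> E \<Longrightarrow> dist (f a) (f b) = dist a b"
  shows "covering_number \<epsilon> (f ` E) = covering_number \<epsilon> E"
proof (rule antisym)
  show "covering_number \<epsilon> (f ` E) \<le> covering_number \<epsilon> E"
    using assms by (intro covering_number_nonexpansive_image_le) auto
  have inj: "inj_on f E"
    using f by (metis dist_eq_0_iff inj_on_def)
  have "bounded (f ` E)"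
  proof -
    obtain c where c: "\<forall>a\<in>E. \<forall>b\<in>E. dist a b \<le> c"
      using assms(1) unfolding bounded_two_points by blast
    show ?thesis
      unfolding bounded_two_points using c f by (intro exI[of _ c]) auto
  qed
  then have "covering_number \<epsilon> (inv_into E f ` f ` E) \<le> covering_number \<epsilon> (f ` E)"
    using assms inj by (intro covering_number_nonexpansive_image_le) auto
  then show "covering_number \<epsilon> E \<le> covering_number \<epsilon> (f ` E)"
    using inj by simp
qed

section \<open>Upper box dimension\<close>

text \<open>The case \<open>n = 0\<close>, the covering number of the empty set, rests on the
  convention \<open>ln 0 = 0\<close>.\<close>

lemma ln_real_of_nat_nonneg: "0 \<le> ln (real n)"
  by (cases "n = 0") auto

lemma ln_real_of_nat_mono: "m \<le> n \<Longrightarrow> ln (real m) \<le> ln (real n)"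
  using ln_real_of_nat_nonneg[of n] by (cases "m = 0") auto

text \<open>At these scales \<open>ln (1 / \<epsilon>)\<close> is positive, so dividing by it
  preserves inequalities.\<close>

lemma eventually_scale_small: "\<forall>\<^sub>F \<epsilon> :: real in at_right 0. 0 < \<epsilon> \<and> \<epsilon> < 1"
  by (rule eventually_at_rightI[of _ 1]) auto

lemma upper_box_dim_empty [simp]: "upper_box_dim ({} :: 'a::metric_space set) = 0"
  by (simp add: upper_box_dim_def Limsup_const zero_ereal_def)

lemma upper_box_dim_mono:
  fixes B :: "'a::euclidean_space set"
  assumes "A \<subseteq> B" "bounded B"
  shows "upper_box_dim A \<le> upper_box_dim B"
  unfolding upper_box_dim_def
proof (rule Limsup_mono, rule eventually_mono[OF eventually_scale_small])
  fix \<epsilon> :: real assume "0 < \<epsilon> \<and> \<epsilon> < 1"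
  then have "ln (real (covering_number \<epsilon> A)) \<le> ln (real (covering_number \<epsilon> B))" "0 \<le> ln (1 / \<epsilon>)"
    using assms by (simp_all add: ln_real_of_nat_mono covering_number_mono)
  then show "ereal (ln (real (covering_number \<epsilon> A)) / ln (1 / \<epsilon>))
      \<le> ereal (ln (real (covering_number \<epsilon> B)) / ln (1 / \<epsilon>))"
    by (simp only: ereal_less_eq divide_right_mono)
qed

lemma upper_box_dim_nonneg:
  fixes E :: "'a::euclidean_space set"
  assumes "bounded E"
  shows "0 \<le> upper_box_dim E"
  using upper_box_dim_mono[of "{}" E] assms by simp

text \<open>The covering number of the union is at most twice the larger of the two, and the factor
  2 costs only \<open>ln 2 / ln (1 / \<epsilon>)\<close>, which tends to 0.\<close>

lemma upper_box_dim_Un: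
  fixes A B :: "'a::euclidean_space set"
  assumes "bounded A" "bounded B"
  shows "upper_box_dim (A \<union> B) = max (upper_box_dim A) (upper_box_dim B)"
proof (rule antisym)
  show "max (upper_box_dim A) (upper_box_dim B) \<le> upper_box_dim (A \<union> B)"
    using assms by (auto intro!: upper_box_dim_mono)
  show "upper_box_dim (A \<union> B) \<le> max (upper_box_dim A) (upper_box_dim B)"
    unfolding upper_box_dim_def[of "A \<union> B"] Limsup_le_iff
  proof (intro allI impI)
    let ?q = "\<lambda>E \<epsilon>. ln (real (covering_number \<epsilon> E)) / ln (1 / \<epsilon>)"
    fix y assume "max (upper_box_dim A) (upper_box_dim B) < y"
    \<comment> \<open>Two real levels are inserted below \<open>y\<close>: both quotients are
      eventually below \<open>c\<close>, and the gap \<open>e - c\<close> absorbs the vanishing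
      term.\<close>
    then obtain c where c: "max (upper_box_dim A) (upper_box_dim B) < ereal c" "ereal c < y"
      using ereal_dense2 by blast
    then obtain e where e: "ereal c < ereal e" "ereal e < y"
      using ereal_dense2 by blast
    have ev: "\<forall>\<^sub>F \<epsilon> in at_right 0. ereal (?q A \<epsilon>) < ereal c" "\<forall>\<^sub>F \<epsilon> in at_right 0. ereal (?q B \<epsilon>) < ereal c"
      using c(1) unfolding upper_box_dim_def max_less_iff_conj by (blast dest: Limsup_lessD)+
    have "((\<lambda>\<epsilon>::real. ln 2 / ln (1 / \<epsilon>)) \<longlongrightarrow> 0) (at_right 0)"
    proof (rule tendsto_divide_0[OF tendsto_const], rule filterlim_at_top_imp_at_infinity)
      show "LIM \<epsilon> at_right 0. ln (1 / \<epsilon> :: real) :> at_top"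
        using filterlim_compose[OF ln_at_top filterlim_inverse_at_top_right]
        by (simp add: inverse_eq_divide)
    qed
    then have "\<forall>\<^sub>F \<epsilon>::real in at_right 0. ln 2 / ln (1 / \<epsilon>) < e - c"
      using e by (intro order_tendstoD) auto
    then show "\<forall>\<^sub>F \<epsilon> in at_right 0. ereal (?q (A \<union> B) \<epsilon>) < y"
      using ev eventually_scale_small
    proof eventually_elim
      case (elim \<epsilon>)
      define m where "m = max (covering_number \<epsilon> A) (covering_number \<epsilon> B)"
      have L: "ln (1 / \<epsilon>) > 0"
        using elim by auto
      have "covering_number \<epsilon> (A \<union> B) \<le> 2 * m"
        using covering_number_Un_le[of A B \<epsilon>] assms elim unfolding m_def by auto
      then have "ln (real (covering_number \<epsilon> (A \<union> B))) \<le> ln (real (2 * m))"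
        by (rule ln_real_of_nat_mono)
      \<comment> \<open>Only an inequality: for \<open>m = 0\<close> the left side is
        \<open>ln 0 = 0\<close>.\<close>
      also have "\<dots> \<le> ln 2 + ln (real m)"
        by (cases "m = 0") (auto simp: ln_mult)
      finally have "?q (A \<union> B) \<epsilon> \<le> (ln 2 + ln (real m)) / ln (1 / \<epsilon>)"
        using L by (intro divide_right_mono) auto
      then have "?q (A \<union> B) \<epsilon> \<le> ln 2 / ln (1 / \<epsilon>) + ln (real m) / ln (1 / \<epsilon>)"
        by (simp only: add_divide_distrib)
      moreover have "ln (real m) / ln (1 / \<epsilon>) < c"
        using elim by (simp add: m_def max_def)
      ultimately have "?q (A \<union> B) \<epsilon> < e"
        using elim by linarith
      then show ?case
        using less_trans[OF _ e(2)] by simp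
    qed
  qed
qed

lemma upper_box_dim_isometric_image:
  fixes f :: "'a::euclidean_space \<Rightarrow> 'b::euclidean_space"
  assumes "bounded E" "\<And>a b. a \<in> E \<Longrightarrow> b \<in> E \<Longrightarrow> dist (f a) (f b) = dist a b"
  shows "upper_box_dim (f ` E) = upper_box_dim E"
  unfolding upper_box_dim_def
proof (rule Limsup_eq, rule eventually_mono[OF eventually_scale_small])
  fix \<epsilon> :: real assume "0 < \<epsilon> \<and> \<epsilon> < 1"
  then show "ereal (ln (real (covering_number \<epsilon> (f ` E))) / ln (1 / \<epsilon>))
      = ereal (ln (real (covering_number \<epsilon> E)) / ln (1 / \<epsilon>))"
    using covering_number_isometric_image[of E \<epsilon> f] assms by simp
qed

section \<open>Point-extended box dimension\<close>

text \<open>Because \<open>ln 0 = 0\<close>, the empty set has upper box dimension 0, so the case \<open>x \<notin> closure E\<close> needs no exception.\<close>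

lemma dim_Pbox_eq_INF:
  fixes E :: "'a::euclidean_space set"
  shows "dim_Pbox x E = (INF r\<in>{0<..}. upper_box_dim (E \<inter> ball x r))"
proof (cases "x \<in> closure E")
  case False
  then obtain r where r: "r > 0" "E \<inter> ball x r = {}"
    unfolding closure_approachable disjoint_iff mem_ball by (metis dist_commute)
  have "(INF r\<in>{0<..}. upper_box_dim (E \<inter> ball x r)) \<le> 0"
    using r INF_lower[of r "{0<..}" "\<lambda>r. upper_box_dim (E \<inter> ball x r)"] by simp
  moreover have "0 \<le> (INF r\<in>{0<..}. upper_box_dim (E \<inter> ball x r))"
    by (intro INF_greatest upper_box_dim_nonneg) (simp add: bounded_Int)
  ultimately show ?thesis
    using False by (simp add: dim_Pbox_def)
qed (simp add: dim_Pbox_def)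

lemma dim_Pbox_nonneg:
  fixes E :: "'a::euclidean_space set"
  shows "0 \<le> dim_Pbox x E"
  unfolding dim_Pbox_eq_INF
  by (intro INF_greatest upper_box_dim_nonneg) (simp add: bounded_Int)

text \<open>Only the germ at \<open>x\<close> counts: shrinking a radius \<open>s\<close> to
  \<open>min r s\<close> brings the comparison inside the ball where the inclusion holds. This is
  how a probe that stays in one branch only near \<open>x\<close> is handled.\<close>

lemma dim_Pbox_mono_local:
  fixes A :: "'a::euclidean_space set"
  assumes "r > 0" "A \<inter> ball x r \<subseteq> B"
  shows "dim_Pbox x A \<le> dim_Pbox x B"
  unfolding dim_Pbox_eq_INF
proof (rule INF_mono)
  fix s :: real assume "s \<in> {0<..}"
  then show "\<exists>t\<in>{0<..}. upper_box_dim (A \<inter> ball x t) \<le> upper_box_dim (B \<inter> ball x s)"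
    using assms
    by (intro bexI[of _ "min r s"] upper_box_dim_mono) (auto simp: bounded_Int)
qed

lemma dim_Pbox_mono:
  fixes A :: "'a::euclidean_space set"
  shows "A \<subseteq> B \<Longrightarrow> dim_Pbox x A \<le> dim_Pbox x B"
  by (rule dim_Pbox_mono_local[of 1]) auto

lemma dim_Pbox_Un:
  fixes A B :: "'a::euclidean_space set"
  shows "dim_Pbox x (A \<union> B) = max (dim_Pbox x A) (dim_Pbox x B)"
proof (rule antisym)
  show "max (dim_Pbox x A) (dim_Pbox x B) \<le> dim_Pbox x (A \<union> B)"
    by (simp add: dim_Pbox_mono)
  show "dim_Pbox x (A \<union> B) \<le> max (dim_Pbox x A) (dim_Pbox x B)"
  \<comment> \<open>The infima over radii need not be attained, so radii are chosen for an arbitrary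
    \<open>y\<close> above both values, and the smaller one serves both sets.\<close>
  proof (rule dense_ge)
    fix y assume y: "max (dim_Pbox x A) (dim_Pbox x B) < y"
    obtain r where r: "r > 0" "upper_box_dim (A \<inter> ball x r) < y"
      using y by (auto simp: dim_Pbox_eq_INF INF_less_iff)
    obtain s where s: "s > 0" "upper_box_dim (B \<inter> ball x s) < y"
      using y by (auto simp: dim_Pbox_eq_INF INF_less_iff)
    have "dim_Pbox x (A \<union> B) \<le> upper_box_dim ((A \<union> B) \<inter> ball x (min r s))"
      unfolding dim_Pbox_eq_INF using r s by (intro INF_lower) auto
    also have "\<dots> \<le> upper_box_dim ((A \<inter> ball x r) \<union> (B \<inter> ball x s))"
      by (rule upper_box_dim_mono) (auto simp: bounded_Int)
    also have "\<dots> \<le> y"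
      using r s by (simp add: upper_box_dim_Un bounded_Int less_imp_le)
    finally show "dim_Pbox x (A \<union> B) \<le> y" .
  qed
qed

lemma dim_Pbox_UN:
  fixes A :: "'i \<Rightarrow> 'a::euclidean_space set"
  assumes "finite I" "I \<noteq> {}"
  shows "dim_Pbox x (\<Union>i\<in>I. A i) = Max ((\<lambda>i. dim_Pbox x (A i)) ` I)"
  using assms by (induction I rule: finite_ne_induct) (auto simp: dim_Pbox_Un)

text \<open>\<open>f\<close> need not be onto: a point \<open>f e\<close> lies in the ball about
  \<open>f x\<close> exactly when \<open>e\<close> lies in the ball about \<open>x\<close>. The
  intended \<open>f\<close> parametrizes a line in the ambient space.\<close>

lemma dim_Pbox_isometric_image:
  fixes f :: "'a::euclidean_space \<Rightarrow> 'b::euclidean_space"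
  assumes "\<And>a b. dist (f a) (f b) = dist a b"
  shows "dim_Pbox (f x) (f ` E) = dim_Pbox x E"
proof -
  have "f ` E \<inter> ball (f x) r = f ` (E \<inter> ball x r)" for r
    using assms by auto
  then show ?thesis
    by (simp add: dim_Pbox_eq_INF upper_box_dim_isometric_image bounded_Int assms)
qed

section \<open>Tangent cones\<close>

text \<open>For a unit vector \<open>u\<close> the ray is cut out by continuous conditions:
  \<open>y\<close> equals its projection onto \<open>u\<close>, and \<open>y \<bullet> u\<close> is
  nonnegative.\<close>

lemma closed_ray:
  fixes u :: "'a::real_inner"
  assumes "norm u = 1"
  shows "closed ((\<lambda>s. s *\<^sub>R u) ` {0..})"
proof -
  have "(\<lambda>s. s *\<^sub>R u) ` {0..} = {y. (y \<bullet> u) *\<^sub>R u = y} \<inter> {y. 0 \<le> y \<bullet> u}"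
    using assms by (force simp: norm_eq_1 image_iff)
  moreover have "closed \<dots>"
    by (intro closed_Int closed_Collect_eq closed_Collect_le continuous_intros)
  ultimately show ?thesis
    by simp
qed

text \<open>Rescaled secants stay in \<open>K\<close> by the cone property, and their limits by
  closedness.\<close>

lemma tangent_cone_subset_closed_cone:
  assumes "closed K" and cone: "\<And>y s. y \<in> K \<Longrightarrow> s \<ge> 0 \<Longrightarrow> s *\<^sub>R y \<in> K"
    and sub: "\<And>a. a \<in> A \<Longrightarrow> a - x \<in> K"
  shows "tangent_cone x A \<subseteq> K"
proof
  fix w assume "w \<in> tangent_cone x A"
  then obtain y l where yl: "\<forall>j::nat. y j \<in> A" "\<forall>j. l j > (0::real)"
      "(\<lambda>j. (y j - x) /\<^sub>R l j) \<longlonglongrightarrow> w"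
    unfolding tangent_cone_def by blast
  have "(y j - x) /\<^sub>R l j \<in> K" for j
    using yl(1,2) by (intro cone sub) (simp_all add: less_imp_le)
  then show "w \<in> K"
    by (rule closed_sequentially[OF \<open>closed K\<close> _ yl(3)])
qed

text \<open>\<open>tangent_cone\<close> asks for monotone scales, so mere convergence to 0 does not
  suffice.\<close>

lemma decreasing_sequence_to_zero:
  fixes S :: "real set"
  assumes "S \<subseteq> {0..}" "0 \<in> closure (S - {0})"
  obtains t where "\<And>n. t n \<in> S" "\<And>n. t n > 0" "decseq t" "t \<longlonglongrightarrow> 0"
proof -
  have ex: "\<exists>s\<in>S. 0 < s \<and> s < e" if e: "e > 0" for e :: real
  proof -
    obtain s where s: "s \<in> S - {0}" "dist s 0 < e"
      using assms(2) e unfolding closure_approachable by blast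
    then have "s \<ge> 0"
      using assms(1) by auto
    with s show ?thesis
      by (intro bexI[of _ s]) auto
  qed
  \<comment> \<open>Each term is chosen below its predecessor, for monotonicity, and below
    \<open>1 / real (Suc n)\<close>, for convergence.\<close>
  have "\<exists>t. \<forall>n. (t n \<in> S \<and> 0 < t n \<and> t n < 1 / real (Suc n)) \<and> t (Suc n) < t n"
  proof (rule dependent_nat_choice[where P = "\<lambda>n s. s \<in> S \<and> 0 < s \<and> s < 1 / real (Suc n)"
        and Q = "\<lambda>_ s r. r < s"])
    show "\<exists>s. s \<in> S \<and> 0 < s \<and> s < 1 / real (Suc 0)"
      using ex[of 1] by auto
  next
    fix s :: real and n :: nat
    assume "s \<in> S \<and> 0 < s \<and> s < 1 / real (Suc n)"
    then have "min s (1 / real (Suc (Suc n))) > 0"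
      by simp
    from ex[OF this] show "\<exists>r. (r \<in> S \<and> 0 < r \<and> r < 1 / real (Suc (Suc n))) \<and> r < s"
      by auto
  qed
  then obtain t where t: "\<And>n. t n \<in> S" "\<And>n. 0 < t n" "\<And>n. t n < 1 / real (Suc n)"
      "\<And>n. t (Suc n) < t n"
    by blast
  have "decseq t"
    using t(4) by (intro decseq_SucI less_imp_le)
  moreover have "t \<longlonglongrightarrow> 0"
  proof (rule tendsto_sandwich)
    show "\<forall>\<^sub>F n in sequentially. 0 \<le> t n"
      using t(2) by (intro always_eventually allI less_imp_le)
    show "\<forall>\<^sub>F n in sequentially. t n \<le> 1 / real (Suc n)"
      using t(3) by (intro always_eventually allI less_imp_le)
    show "(\<lambda>n. 1 / real (Suc n)) \<longlonglongrightarrow> 0"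
      using LIMSEQ_inverse_real_of_nat by (simp add: inverse_eq_divide)
  qed simp
  ultimately show thesis
    using t(1,2) that by blast
qed

text \<open>Using the parameters themselves as scales makes the rescaled secants constantly
  \<open>u\<close>.\<close>

lemma direction_in_tangent_cone:
  assumes "\<And>s. s \<in> S \<Longrightarrow> x + s *\<^sub>R u \<in> A" "S \<subseteq> {0..}" "0 \<in> closure (S - {0})"
  shows "u \<in> tangent_cone x A"
proof -
  obtain t where t: "\<And>n. t n \<in> S" "\<And>n. t n > 0" "decseq t" "t \<longlonglongrightarrow> 0"
    using decreasing_sequence_to_zero[OF assms(2,3)] by blast
  have "(\<lambda>n. x + t n *\<^sub>R u) \<longlonglongrightarrow> x"
    using tendsto_add[OF tendsto_const[of x] tendsto_scaleR[OF t(4) tendsto_const[of u]]] by simp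
  moreover have "(\<lambda>n. (x + t n *\<^sub>R u - x) /\<^sub>R t n) = (\<lambda>n. u)"
    using t(2) by (simp add: fun_eq_iff less_imp_neq[symmetric])
  ultimately show ?thesis
    unfolding tangent_cone_def using t assms(1)
    by (intro CollectI exI[of _ "\<lambda>n. x + t n *\<^sub>R u"] exI[of _ t]) simp
qed

section \<open>Projective independence\<close>

text \<open>If two members with different indices spanned the same line, one would lie in the span
  of the others.\<close>

lemma independent_family_proj_class_inj:
  assumes "independent_family I w" "i \<in> I" "j \<in> I" "proj_class (w i) = proj_class (w j)"
  shows "i = j"
proof (rule ccontr)
  assume "i \<noteq> j"
  then have "w j \<in> w ` I - {w i}"
    using assms unfolding independent_family_def inj_on_def by blast
  moreover have "w i \<in> span {w j}"
    using assms(4) span_base[of "w i" "{w i}"] unfolding proj_class_def by simp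
  ultimately have "w i \<in> span (w ` I - {w i})"
    using span_mono[of "{w j}" "w ` I - {w i}"] by auto
  then show False
    using assms unfolding independent_family_def dependent_def by blast
qed

lemma proj_independent_imp_inj_on: "proj_independent I \<xi> \<Longrightarrow> inj_on \<xi> I"
  unfolding proj_independent_def
  by (metis independent_family_proj_class_inj inj_onI)

section \<open>Probes\<close>

text \<open>A probe is a homeomorphism onto its image, so points of the probe near \<open>x\<close> have small parameters.\<close>

lemma probe_small_parameters:
  assumes "(\<delta>, \<gamma>) \<in> probes x A w" "\<eta> > 0"
  obtains r where "r > 0" "\<And>t. t \<in> {0..\<delta>} \<Longrightarrow> \<gamma> t \<in> ball x r \<Longrightarrow> t < \<eta>"
proof -
  obtain L where \<gamma>: "\<delta> > 0" "inj_on \<gamma> {0..\<delta>}" "L-lipschitz_on {0..\<delta>} \<gamma>" "\<gamma> 0 = x"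
    using assms(1) unfolding probes_def by blast
  have "continuous_on {\<eta>..\<delta>} \<gamma>"
    using lipschitz_on_continuous_on[OF \<gamma>(3)] by (rule continuous_on_subset) (use \<open>\<eta> > 0\<close> in auto)
  then have "closed (\<gamma> ` {\<eta>..\<delta>})"
    by (intro compact_imp_closed compact_continuous_image) auto
  moreover have "x \<notin> \<gamma> ` {\<eta>..\<delta>}"
  proof
    assume "x \<in> \<gamma> ` {\<eta>..\<delta>}"
    then obtain t where t: "t \<in> {\<eta>..\<delta>}" "\<gamma> t = \<gamma> 0"
      using \<gamma>(4) by auto
    have "t = 0"
      by (rule inj_onD[OF \<gamma>(2) t(2)]) (use t \<open>\<eta> > 0\<close> \<gamma>(1) in auto)
    then show False
      using t \<open>\<eta> > 0\<close> by simp
  qed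
  ultimately obtain r where r: "r > 0" "ball x r \<subseteq> - \<gamma> ` {\<eta>..\<delta>}"
    by (metis ComplI open_Compl open_contains_ball)
  show thesis
  proof (rule that[OF r(1)])
    fix t assume t: "t \<in> {0..\<delta>}" "\<gamma> t \<in> ball x r"
    show "t < \<eta>"
    proof (rule ccontr)
      assume "\<not> t < \<eta>"
      then have "\<gamma> t \<in> \<gamma> ` {\<eta>..\<delta>}"
        using t(1) by auto
      then show False
        using r(2) t(2) by blast
    qed
  qed
qed

text \<open>Supplies the lower bound for the contribution of a direction. The secants are constantly
  \<open>u\<close>, and \<open>A\<close> is met at arbitrarily small parameters because 0 is a limit
  point of \<open>S\<close>.\<close>

lemma straight_probe:
  fixes u :: "'a::real_normed_vector"
  assumes "norm u = 1" "\<delta> > 0" "\<And>s. s \<in> S \<Longrightarrow> x + s *\<^sub>R u \<in> A" "S \<subseteq> {0..}" "0 \<in> closure (S - {0})"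
  shows "(\<delta>, \<lambda>t. x + t *\<^sub>R u) \<in> probes x A u"
proof -
  have "u \<noteq> 0"
    using assms(1) by auto
  have "inj_on (\<lambda>t. x + t *\<^sub>R u) {0..\<delta>}"
    using \<open>u \<noteq> 0\<close> by (intro inj_onI) simp
  moreover have "1-lipschitz_on {0..\<delta>} (\<lambda>t. x + t *\<^sub>R u)"
    using assms(1)
    by (intro lipschitz_onI) (auto simp: dist_norm simp flip: scaleR_diff_left)
  moreover have "((\<lambda>t. (x + t *\<^sub>R u - x) /\<^sub>R norm (x + t *\<^sub>R u - x)) \<longlongrightarrow> u) (at_right 0)"
    by (rule tendsto_eventually, rule eventually_at_rightI[of _ 1]) (use assms(1) in auto)
  moreover have "A \<inter> (\<lambda>t. x + t *\<^sub>R u) ` {0<..\<eta>} \<noteq> {}" if "\<eta> \<in> {0<..\<delta>}" for \<eta>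
  proof -
    have "\<eta> > 0"
      using that by simp
    then obtain s where s: "s \<in> S - {0}" "dist s 0 < \<eta>"
      using assms(5) unfolding closure_approachable by blast
    then have "s \<in> {0<..\<eta>}"
      using assms(4) by auto
    then show ?thesis
      using s assms(3) by blast
  qed
  ultimately show ?thesis
    unfolding probes_def using \<open>\<delta> > 0\<close> by auto
qed

section \<open>Finite unions of subsets of independent rays\<close>

text \<open>\<open>k_ge\<close> puts \<open>x\<close> into the union and makes the maximum over the
  branches one over a nonempty set. Linear independence of the \<open>v i\<close> expresses
  projective independence of their classes.\<close>

locale ray_union =
  fixes x :: "'a::euclidean_space" and v :: "nat \<Rightarrow> 'a" and F :: "nat \<Rightarrow> real set" and k :: nat
  assumes k_ge: "k \<ge> 1"
    and norm_v: "i \<in> {1..k} \<Longrightarrow> norm (v i) = 1"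
    and indep: "independent_family {1..k} v"
    and F_nonneg: "i \<in> {1..k} \<Longrightarrow> F i \<subseteq> {0..}"
    and F_bounded: "i \<in> {1..k} \<Longrightarrow> bounded (F i)"
    and zero_in_F: "i \<in> {1..k} \<Longrightarrow> 0 \<in> F i"
    and zero_limit: "i \<in> {1..k} \<Longrightarrow> 0 \<in> closure (F i - {0})"
begin

definition branch :: "nat \<Rightarrow> 'a set" where
  "branch i = (\<lambda>t. x + t *\<^sub>R v i) ` F i"

definition carrier :: "'a set" where
  "carrier = (\<Union>i\<in>{1..k}. branch i)"

lemma branch_subset: "i \<in> {1..k} \<Longrightarrow> branch i \<subseteq> carrier"
  unfolding carrier_def by blast

lemma branch_pointI: "s \<in> F i \<Longrightarrow> x + s *\<^sub>R v i \<in> branch i"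
  unfolding branch_def by blast

lemma dim_Pbox_branch:
  assumes "i \<in> {1..k}"
  shows "dim_Pbox x (branch i) = dim_Pbox 0 (F i)"
proof -
  have "dist (x + s *\<^sub>R v i) (x + t *\<^sub>R v i) = dist s t" for s t
    using norm_v[OF assms] by (simp add: dist_norm flip: scaleR_diff_left)
  from dim_Pbox_isometric_image[of "\<lambda>t. x + t *\<^sub>R v i", OF this, of 0 "F i"] show ?thesis
    by (simp add: branch_def)
qed

lemma dim_Pbox_carrier: "dim_Pbox x carrier = Max ((\<lambda>i. dim_Pbox 0 (F i)) ` {1..k})"
proof -
  have "dim_Pbox x carrier = Max ((\<lambda>i. dim_Pbox x (branch i)) ` {1..k})"
    unfolding carrier_def using k_ge by (intro dim_Pbox_UN) auto
  then show ?thesis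
    by (simp add: dim_Pbox_branch cong: image_cong_simp)
qed

text \<open>The finite union of closed rays is a closed cone containing all secant vectors
  \<open>a - x\<close>.\<close>

lemma tangent_cone_carrier_subset: "tangent_cone x carrier \<subseteq> (\<Union>i\<in>{1..k}. (\<lambda>s. s *\<^sub>R v i) ` {0..})"
proof (rule tangent_cone_subset_closed_cone)
  show "closed (\<Union>i\<in>{1..k}. (\<lambda>s. s *\<^sub>R v i) ` {0..})"
    by (intro closed_UN ballI closed_ray norm_v) auto
next
  fix y and s :: real
  assume "y \<in> (\<Union>i\<in>{1..k}. (\<lambda>s. s *\<^sub>R v i) ` {0..})" and s: "s \<ge> 0"
  then obtain i r where i: "i \<in> {1..k}" "r \<ge> 0" "y = r *\<^sub>R v i"
    by auto
  then have "s *\<^sub>R y = (s * r) *\<^sub>R v i" "s * r \<in> {0..}"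
    using s by auto
  then show "s *\<^sub>R y \<in> (\<Union>i\<in>{1..k}. (\<lambda>s. s *\<^sub>R v i) ` {0..})"
    using i(1) by blast
next
  fix a assume "a \<in> carrier"
  then obtain i s where i: "i \<in> {1..k}" "s \<in> F i" "a = x + s *\<^sub>R v i"
    unfolding carrier_def branch_def by auto
  then have "a - x = s *\<^sub>R v i" "s \<in> {0..}"
    using F_nonneg by auto
  then show "a - x \<in> (\<Union>i\<in>{1..k}. (\<lambda>s. s *\<^sub>R v i) ` {0..})"
    using i(1) by blast
qed

lemma v_in_tangent_cone:
  assumes "i \<in> {1..k}"
  shows "v i \<in> tangent_cone x carrier"
proof (rule direction_in_tangent_cone)
  show "x + s *\<^sub>R v i \<in> carrier" if "s \<in> F i" for s
    using that branch_subset[OF assms] branch_pointI by blast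
qed (use assms F_nonneg zero_limit in auto)

lemma Eff_carrier: "Eff x carrier = v ` {1..k}"
proof -
  \<comment> \<open>The base point is written as the point of parameter 0 on the first
    branch.\<close>
  have "x + 0 *\<^sub>R v 1 \<in> carrier"
    using k_ge zero_in_F[of 1] branch_pointI[of 0 1] branch_subset[of 1] by auto
  then have "x \<in> closure carrier"
    using closure_subset by auto
  moreover have "tangent_cone x carrier \<inter> sphere 0 1 = v ` {1..k}"
  proof (intro equalityI subsetI)
    fix w assume w: "w \<in> tangent_cone x carrier \<inter> sphere 0 1"
    then obtain i s where i: "i \<in> {1..k}" "s \<ge> 0" "w = s *\<^sub>R v i"
      using tangent_cone_carrier_subset by auto
    \<comment> \<open>Both \<open>w\<close> and \<open>v i\<close> are unit vectors and
      \<open>s\<close> is nonnegative.\<close>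
    then have "s = 1"
      using w norm_v by simp
    then show "w \<in> v ` {1..k}"
      using i by simp
  qed (use v_in_tangent_cone norm_v in auto)
  ultimately show ?thesis
    unfolding Eff_def by simp
qed

lemma Eff_proj_carrier: "Eff_proj x carrier = (\<lambda>i. proj_class (v i)) ` {1..k}"
  unfolding Eff_proj_def Eff_carrier by (simp add: image_image)

text \<open>The tangent cone lies between the set of the \<open>v i\<close> and its span, so it has
  the same span.\<close>

lemma dim_Ptan_carrier: "dim_Ptan x carrier = k"
proof -
  have "tangent_cone x carrier \<subseteq> span (v ` {1..k})"
    using tangent_cone_carrier_subset by (force intro: span_scale span_base)
  moreover have "v ` {1..k} \<subseteq> tangent_cone x carrier"
    using v_in_tangent_cone by auto
  ultimately have "span (tangent_cone x carrier) = span (v ` {1..k})"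
    by (intro antisym span_minimal subspace_span) (auto intro: span_base)
  then show ?thesis
    using indep unfolding dim_Ptan_def independent_family_def
    by (simp add: dim_eq_card_independent card_image)
qed

lemma v_inj: "i \<in> {1..k} \<Longrightarrow> j \<in> {1..k} \<Longrightarrow> v i = v j \<Longrightarrow> i = j"
  using indep unfolding independent_family_def inj_on_def by blast

text \<open>The secants from \<open>x\<close> to points of another branch have the constant direction \<open>v j \<noteq> v i\<close>.\<close>

lemma probe_eventually_in_branch:
  assumes i: "i \<in> {1..k}" and p: "(\<delta>, \<gamma>) \<in> probes x carrier (v i)"
  obtains r where "r > 0" "carrier \<inter> \<gamma> ` {0..\<delta>} \<inter> ball x r \<subseteq> branch i"
proof -
  have \<gamma>: "\<delta> > 0" "inj_on \<gamma> {0..\<delta>}" "\<gamma> 0 = x"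
      "((\<lambda>t. (\<gamma> t - x) /\<^sub>R norm (\<gamma> t - x)) \<longlongrightarrow> v i) (at_right 0)"
    using p unfolding probes_def by auto
  have "\<forall>j\<in>{1..k} - {i}. \<forall>\<^sub>F t in at_right 0. (\<gamma> t - x) /\<^sub>R norm (\<gamma> t - x) \<noteq> v j"
    using v_inj i by (intro ballI tendsto_imp_eventually_ne[OF \<gamma>(4)]) auto
  \<comment> \<open>Finiteness of the index set yields one parameter bound for all the other
    branches.\<close>
  then have "\<forall>\<^sub>F t in at_right 0. \<forall>j\<in>{1..k} - {i}. (\<gamma> t - x) /\<^sub>R norm (\<gamma> t - x) \<noteq> v j"
    by (intro eventually_ball_finite) auto
  then obtain \<eta> where \<eta>: "\<eta> > 0"
      "\<And>t j. 0 < t \<Longrightarrow> t < \<eta> \<Longrightarrow> j \<in> {1..k} - {i} \<Longrightarrow> (\<gamma> t - x) /\<^sub>R norm (\<gamma> t - x) \<noteq> v j"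
    unfolding eventually_at_right_field by blast
  obtain r where r: "r > 0" "\<And>t. t \<in> {0..\<delta>} \<Longrightarrow> \<gamma> t \<in> ball x r \<Longrightarrow> t < \<eta>"
    using probe_small_parameters[OF p \<eta>(1)] by blast
  show thesis
  proof (rule that[OF r(1)], rule subsetI)
    fix a assume a: "a \<in> carrier \<inter> \<gamma> ` {0..\<delta>} \<inter> ball x r"
    then obtain t where t: "t \<in> {0..\<delta>}" "a = \<gamma> t"
      by blast
    have "t < \<eta>"
      using r(2)[OF t(1)] a t(2) by simp
    obtain j s where j: "j \<in> {1..k}" "s \<in> F j" "a = x + s *\<^sub>R v j"
      using a unfolding carrier_def branch_def by blast
    show "a \<in> branch i"
    \<comment> \<open>At \<open>t = 0\<close> there is no secant direction, but the point is
      \<open>x\<close>, which every branch contains. For other parameters injectivity of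
      \<open>\<gamma>\<close> keeps the point away from \<open>x\<close>.\<close>
    proof (cases "t = 0")
      case True
      then have "a = x + 0 *\<^sub>R v i"
        using t(2) \<gamma>(3) by simp
      then show ?thesis
        using branch_pointI[OF zero_in_F[OF i]] by simp
    next
      case False
      then have "\<gamma> t \<noteq> \<gamma> 0"
        using inj_onD[OF \<gamma>(2), of t 0] t(1) \<gamma>(1) by auto
      then have "s \<noteq> 0"
        using j(3) t(2) \<gamma>(3) by auto
      then have "s > 0"
        using F_nonneg[OF j(1)] j(2) by (force simp: less_le)
      then have "(\<gamma> t - x) /\<^sub>R norm (\<gamma> t - x) = v j"
        using j(3) t(2) norm_v[OF j(1)] by simp
      then have "j = i"
        using \<eta>(2)[of t j] False t(1) \<open>t < \<eta>\<close> j(1) by auto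
      then show ?thesis
        using j branch_pointI by simp
    qed
  qed
qed

text \<open>The upper bound localizes an arbitrary probe to the \<open>i\<close>-th branch; the
  lower bound comes from the straight probe.\<close>

lemma theta_carrier:
  assumes i: "i \<in> {1..k}"
  shows "theta x carrier (v i) = dim_Pbox 0 (F i)"
proof (rule antisym)
  have "dim_Pbox x (carrier \<inter> \<gamma> ` {0..\<delta>}) \<le> dim_Pbox 0 (F i)"
    if p: "(\<delta>, \<gamma>) \<in> probes x carrier (v i)" for \<delta> \<gamma>
  proof -
    obtain r where r: "r > 0" "carrier \<inter> \<gamma> ` {0..\<delta>} \<inter> ball x r \<subseteq> branch i"
      by (rule probe_eventually_in_branch[OF i p])
    show ?thesis
      using dim_Pbox_mono_local[OF r] unfolding dim_Pbox_branch[OF i] .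
  qed
  then show "theta x carrier (v i) \<le> dim_Pbox 0 (F i)"
    unfolding theta_def by (intro SUP_least) auto
next
  \<comment> \<open>A bound for \<open>F i\<close> serves as the length of the straight probe, which
    then covers the whole branch.\<close>
  obtain \<delta> where \<delta>: "\<delta> > 0" "\<And>t. t \<in> F i \<Longrightarrow> norm t \<le> \<delta>"
    using F_bounded[OF i] unfolding bounded_pos by blast
  have "(\<delta>, \<lambda>t. x + t *\<^sub>R v i) \<in> probes x carrier (v i)"
  proof (rule straight_probe[OF norm_v[OF i] \<delta>(1) _ F_nonneg[OF i] zero_limit[OF i]])
    show "x + s *\<^sub>R v i \<in> carrier" if "s \<in> F i" for s
      using that branch_subset[OF i] branch_pointI by blast
  qed
  then have "dim_Pbox x (carrier \<inter> (\<lambda>t. x + t *\<^sub>R v i) ` {0..\<delta>}) \<le> theta x carrier (v i)"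
    unfolding theta_def by (rule SUP_upper2) simp
  moreover have "F i \<subseteq> {0..\<delta>}"
    using \<delta>(2) F_nonneg[OF i] by fastforce
  then have "branch i \<subseteq> carrier \<inter> (\<lambda>t. x + t *\<^sub>R v i) ` {0..\<delta>}"
    using branch_subset[OF i] unfolding branch_def by blast
  then have "dim_Pbox x (branch i) \<le> dim_Pbox x (carrier \<inter> (\<lambda>t. x + t *\<^sub>R v i) ` {0..\<delta>})"
    by (rule dim_Pbox_mono)
  ultimately show "dim_Pbox 0 (F i) \<le> theta x carrier (v i)"
    unfolding dim_Pbox_branch[OF i] by (rule order_trans[rotated])
qed

text \<open>By independence no other effective direction, in particular not \<open>- v i\<close>,
  spans the same line, so the supremum is over a single vector.\<close>

lemma theta_proj_carrier:
  assumes i: "i \<in> {1..k}"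
  shows "theta_proj x carrier (proj_class (v i)) = dim_Pbox 0 (F i)"
proof -
  have "{w \<in> Eff x carrier. proj_class w = proj_class (v i)} = {v i}"
    using i independent_family_proj_class_inj[OF indep] unfolding Eff_carrier by blast
  then show ?thesis
    unfolding theta_proj_def using theta_carrier[OF i] by simp
qed

lemma dim_cross_carrier: "dim_cross x carrier = (\<Sum>i=1..k. dim_Pbox 0 (F i))"
  unfolding dim_cross_def
proof (intro antisym Sup_least Sup_upper)
  \<comment> \<open>Lower bound: the full family is admissible, its size being limited by the
    dimension.\<close>
  have "k \<le> DIM('a)"
    using indep independent_bound[of "v ` {1..k}"]
    unfolding independent_family_def by (simp add: card_image)
  moreover have "proj_independent {1..k} (\<lambda>i. proj_class (v i))"
    unfolding proj_independent_def using indep norm_v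
    by (intro exI[of _ v]) fastforce
  moreover have "(\<Sum>i=1..k. dim_Pbox 0 (F i))
      = (\<Sum>i=1..k. theta_proj x carrier (proj_class (v i)))"
    by (intro sum.cong refl theta_proj_carrier[symmetric])
  ultimately show "(\<Sum>i=1..k. dim_Pbox 0 (F i))
      \<in> {(\<Sum>i=1..m. theta_proj x carrier (\<xi> i)) | m \<xi>. m \<le> DIM('a) \<and>
           (\<forall>i\<in>{1..m::nat}. \<xi> i \<in> Eff_proj x carrier) \<and> proj_independent {1..m} \<xi>}"
    unfolding Eff_proj_carrier
    by (intro CollectI exI[of _ k] exI[of _ "\<lambda>i. proj_class (v i)"]) simp
next
  fix y
  assume "y \<in> {(\<Sum>i=1..m. theta_proj x carrier (\<xi> i)) | m \<xi>. m \<le> DIM('a) \<and>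
           (\<forall>i\<in>{1..m::nat}. \<xi> i \<in> Eff_proj x carrier) \<and> proj_independent {1..m} \<xi>}"
  then obtain m \<xi> where y: "y = (\<Sum>j=1..m. theta_proj x carrier (\<xi> j))"
      and \<xi>: "\<forall>j\<in>{1..m::nat}. \<xi> j \<in> Eff_proj x carrier" "proj_independent {1..m} \<xi>"
    by blast
  \<comment> \<open>Upper bound: each class of a competing family is that of some branch, and
    \<open>\<sigma>\<close> selects it.\<close>
  then have "\<forall>j\<in>{1..m}. \<exists>i. i \<in> {1..k} \<and> \<xi> j = proj_class (v i)"
    unfolding Eff_proj_carrier by blast
  then obtain \<sigma> where \<sigma>: "\<And>j. j \<in> {1..m} \<Longrightarrow> \<sigma> j \<in> {1..k}"
      "\<And>j. j \<in> {1..m} \<Longrightarrow> \<xi> j = proj_class (v (\<sigma> j))"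
    by metis
  \<comment> \<open>Projectively independent classes are distinct, so no branch is counted twice;
    the sum becomes a partial sum of nonnegative terms.\<close>
  have inj: "inj_on \<sigma> {1..m}"
    using proj_independent_imp_inj_on[OF \<xi>(2)] \<sigma>(2) unfolding inj_on_def by metis
  have "y = (\<Sum>j=1..m. dim_Pbox 0 (F (\<sigma> j)))"
    unfolding y using \<sigma> by (intro sum.cong refl) (simp add: theta_proj_carrier)
  also have "\<dots> = (\<Sum>i\<in>\<sigma> ` {1..m}. dim_Pbox 0 (F i))"
    using inj by (simp add: sum.reindex)
  also have "\<dots> \<le> (\<Sum>i=1..k. dim_Pbox 0 (F i))"
    using \<sigma>(1) by (intro sum_mono2 dim_Pbox_nonneg) auto
  finally show "y \<le> (\<Sum>i=1..k. dim_Pbox 0 (F i))" .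
qed

text \<open>A maximum of nonnegative terms is at most their sum, so the cross dimension
  wins.\<close>

lemma dim_boxcross_carrier: "dim_boxcross x carrier = (\<Sum>i=1..k. dim_Pbox 0 (F i))"
proof -
  have "dim_Pbox 0 (F i) \<le> (\<Sum>i=1..k. dim_Pbox 0 (F i))" if "i \<in> {1..k}" for i
    using that sum_mono2[of "{1..k}" "{i}" "\<lambda>i. dim_Pbox 0 (F i)"] by (simp add: dim_Pbox_nonneg)
  then have "dim_Pbox x carrier \<le> (\<Sum>i=1..k. dim_Pbox 0 (F i))"
    unfolding dim_Pbox_carrier using k_ge by (intro Max.boundedI) auto
  then show ?thesis
    unfolding dim_boxcross_def dim_cross_carrier by (rule max_absorb2)
qed

end

theorem proposition4p44:
  fixes x :: "real ^ 'n" and v :: "nat \<Rightarrow> real ^ 'n"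
    and F :: "nat \<Rightarrow> real set" and \<rho> :: real and k :: nat
    and \<F> :: "(real ^ 'n) set" and d :: "nat \<Rightarrow> ereal"
  assumes "k \<ge> 1"
    and "\<And>i. i \<in> {1..k} \<Longrightarrow> v i \<in> sphere 0 1"
    and "independent_family {1..k} v"
    and "\<And>i. i \<in> {1..k} \<Longrightarrow> F i \<subseteq> {0..\<rho>}"
    and "\<And>i. i \<in> {1..k} \<Longrightarrow> bounded (F i)"
    and "\<And>i. i \<in> {1..k} \<Longrightarrow> 0 \<in> F i"
    and "\<And>i. i \<in> {1..k} \<Longrightarrow> 0 \<in> closure (F i - {0})"
  defines "\<F> \<equiv> (\<Union>i\<in>{1..k}. {x + t *\<^sub>R v i | t. t \<in> F i})"
    and "d \<equiv> (\<lambda>i. dim_Pbox 0 (F i))"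
  shows "Eff_proj x \<F> = {proj_class (v i) | i. i \<in> {1..k}} \<and>
         (\<forall>i\<in>{1..k}. theta_proj x \<F> (proj_class (v i)) = d i) \<and>
         dim_cross x \<F> = (\<Sum>i=1..k. d i) \<and>
         dim_Pbox x \<F> = Max {d i | i. i \<in> {1..k}} \<and>
         dim_boxcross x \<F> = (\<Sum>i=1..k. d i) \<and>
         dim_Ptan x \<F> = k"
proof -
  interpret ray_union x v F k
  proof
    show "norm (v i) = 1" if "i \<in> {1..k}" for i
      using assms(2)[OF that] by simp
    show "F i \<subseteq> {0..}" if "i \<in> {1..k}" for i
      using assms(4)[OF that] by auto
  qed (fact assms(1,3,5-7))+
  have eq: "\<F> = carrier"
    unfolding \<F>_def carrier_def branch_def by blast
  \<comment> \<open>The comprehensions are turned into images, the form in which the results for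
    \<open>carrier\<close> are stated.\<close>
  have "{proj_class (v i) | i. i \<in> {1..k}} = (\<lambda>i. proj_class (v i)) ` {1..k}"
    "{d i | i. i \<in> {1..k}} = (\<lambda>i. dim_Pbox 0 (F i)) ` {1..k}"
    unfolding d_def by blast+
  then show ?thesis
    unfolding eq d_def
    by (intro conjI ballI)
      (simp_all only: Eff_proj_carrier theta_proj_carrier dim_cross_carrier dim_Pbox_carrier
        dim_boxcross_carrier dim_Ptan_carrier)
qed

end
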